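(* For $k\in\mathcal{I}$ let $m_k=(k^2-1)/3$ and $n_k=m_k+2k+2$, let $k^+$ denote the smallest element of $\mathcal{I}$ larger than $k$, and partition the set of consecutive integers $\{m_k,\dots,n_k\}$ in two ways as $$\{m_k,\dots,n_k\}=A_k\cup B_k,\qquad A_k=\{m_k,\dots,m_{k^+}\},\quad B_k=\{m_{k^+}+1,\dots,n_k\},$$ $$\{m_k,\dots,n_k\}=C_k\cup D_k,\qquad C_k=\{m_k,\dots,m_{k^+}-1\},\quad D_k=\{m_{k^+},\dots,n_k\}.$$ Then for every $k\in\mathcal{I}$ the following pairs of naturals are coprime: (i) $|A_k|$ and $|B_k|$; (ii) $|C_k|$ and $|D_k|$; (iii) $|A_k|$ and $|C_k|$; (iv) $|B_k|$ and $|D_k|$. Moreover, each of the sequences $(|A_k|)_{k\in\mathcal{I}}$, $(|B_k|)_{k\in\mathcal{I}}$, $(|C_k|)_{k\in\mathcal{I}}$ and $(|D_k|)_{k\in\mathcal{I}}$ is non-repeating in $k$ (has pairwise distinct terms), and $$\{|C_1|,|B_2|,|C_4|,|B_5|,\dots\}=\{|C_{1+3j}|:j\ge0\}\cup\{|B_{2+3j}|:j\ge0\}=\mathbb{N}_{\ge1}.$$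
   Context: $\mathcal{I}=\mathbb{N}_{\ge1}\setminus3\mathbb{N}_{\ge1}=\{1,2,4,5,7,8,\dots\}$ is the set of positive integers that are not multiples of three. $|X|$ denotes the cardinality of a finite set $X$. The sets $\{m_k,\dots,n_k\}$, $k\in\mathcal{I}$, are the supports of the orthogonal dice (discrete uniform distributions on consecutive nonnegative integers whose mean equals their variance). *)

theory Defs
  imports Complex_Main
begin

definition index_set :: "nat set" where
  "index_set = {1..} - {3 * j |j. 1 \<le> j}"

(* The truncated subtraction and the truncated division are both exact for indices,
   see lower_end_exact. *)
definition lower_end :: "nat \<Rightarrow> nat" where
  "lower_end k = (k^2 - 1) div 3"

definition upper_end :: "nat \<Rightarrow> nat" where
  "upper_end k = lower_end k + 2 * k + 2"

definition next_index :: "nat \<Rightarrow> nat" where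
  "next_index k = (LEAST l. l \<in> index_set \<and> k < l)"

definition block_A :: "nat \<Rightarrow> nat set" where
  "block_A k = {lower_end k .. lower_end (next_index k)}"

definition block_B :: "nat \<Rightarrow> nat set" where
  "block_B k = {lower_end (next_index k) + 1 .. upper_end k}"

(* The half-open interval has last element lower_end (next_index k) - 1. *)
definition block_C :: "nat \<Rightarrow> nat set" where
  "block_C k = {lower_end k ..< lower_end (next_index k)}"

definition block_D :: "nat \<Rightarrow> nat set" where
  "block_D k = {lower_end (next_index k) .. upper_end k}"

lemma lower_end_exact:
  assumes "k \<in> index_set"
  shows "real (lower_end k) = (real k ^ 2 - 1) / 3"
proof -
  have k: "k \<ge> 1" and n3: "\<not> 3 dvd k"
    using assms by (auto simp: index_set_def dvd_def)
  obtain q where "k = 3 * q + 1 \<or> k = 3 * q + 2"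
    using n3 by (metis dvd_def mult_div_mod_eq mod_less_divisor zero_less_numeral
        less_Suc_eq numeral_3_eq_3 One_nat_def Suc_1 add_0_right less_Suc0)
  then have "k^2 - 1 = 3 * (3 * q^2 + 2 * q) \<or> k^2 - 1 = 3 * (3 * q^2 + 4 * q + 1)"
    by (auto simp: power2_eq_square algebra_simps)
  then have "3 dvd k^2 - 1" by (metis dvd_triv_left)
  then have "3 * lower_end k = k^2 - 1"
    by (simp add: lower_end_def)
  then have "3 * lower_end k + 1 = k^2"
    using k by simp
  then have "real (3 * lower_end k + 1) = real (k^2)" by presburger
  then show ?thesis by simp
qed

end

theory Submission
  imports Defs
begin

text \<open>
  Everything is decided by the residue of the index modulo 3. With \<open>m = lower_end k\<close>, an index
  \<open>k = 3 * j + 1\<close> has \<open>m = 3 * j^2 + 2 * j\<close> and is followed by \<open>3 * j + 2\<close>, while \<open>k = 3 * j + 2\<close>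
  has \<open>m = 3 * j^2 + 4 * j + 1\<close> and is followed by \<open>3 * (j + 1) + 1\<close>. The quadratic terms cancel in
  differences of consecutive lower ends, so all block sizes are linear in \<open>j\<close>; in the order
  \<open>A, B, C, D\<close> they are
  \<^item> \<open>2 * j + 2, 4 * j + 3, 2 * j + 1, 4 * j + 4\<close> for \<open>k = 3 * j + 1\<close>,
  \<^item> \<open>4 * j + 5, 2 * j + 2, 4 * j + 4, 2 * j + 3\<close> for \<open>k = 3 * j + 2\<close>.

  Coprimality: \<open>|A| = |C| + 1\<close> and \<open>|D| = |B| + 1\<close> settle two of the four pairs. In each of the other
  two, twice the smaller linear form differs from the larger one by 1 (for \<open>A, B\<close>) or by 2 (for
  \<open>C, D\<close>), and in the latter case the smaller form is odd.

  Non-repetition: for each kind of block both linear forms are strictly increasing, and one takes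
  even values only, the other odd values only, so that no size is shared between the two residue classes.

  The final union is the set of all odd numbers \<open>2 * j + 1\<close> (from \<open>C\<close>) together with that of all
  positive even numbers \<open>2 * j + 2\<close> (from \<open>B\<close>).
\<close>

lemma index_set_iff: "k \<in> index_set \<longleftrightarrow> (\<exists>j. k = 3 * j + 1) \<or> (\<exists>j. k = 3 * j + 2)"
proof -
  have "k \<in> index_set \<longleftrightarrow> k mod 3 \<noteq> 0"
  proof -
    have "k \<in> index_set \<longleftrightarrow> 1 \<le> k \<and> \<not> (\<exists>j. k = 3 * j \<and> 1 \<le> j)"
      by (auto simp: index_set_def)
    also have "\<dots> \<longleftrightarrow> k mod 3 \<noteq> 0" by presburger
    finally show ?thesis .
  qed
  also have "\<dots> \<longleftrightarrow> (\<exists>j. k = 3 * j + 1) \<or> (\<exists>j. k = 3 * j + 2)" by presburger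
  finally show ?thesis .
qed

lemma index_set_cases:
  assumes "k \<in> index_set"
  obtains (one) j where "k = 3 * j + 1" | (two) j where "k = 3 * j + 2"
  using assms by (auto simp: index_set_iff)

lemma next_index_one: "next_index (3 * j + 1) = 3 * j + 2"
  unfolding next_index_def
proof (rule Least_equality)
  show "3 * j + 2 \<in> index_set \<and> 3 * j + 1 < 3 * j + 2"
    by (auto simp: index_set_iff)
qed simp

lemma next_index_two: "next_index (3 * j + 2) = 3 * (j + 1) + 1"
  unfolding next_index_def
proof (rule Least_equality)
  show "3 * (j + 1) + 1 \<in> index_set \<and> 3 * j + 2 < 3 * (j + 1) + 1"
    unfolding index_set_iff by (intro conjI disjI1 exI[of _ "j + 1"]) simp_all
next
  fix l assume "l \<in> index_set \<and> 3 * j + 2 < l"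
  then show "3 * (j + 1) + 1 \<le> l"
    unfolding index_set_iff by (elim conjE disjE exE) presburger+
qed

lemma lower_end_one: "lower_end (3 * j + 1) = 3 * j^2 + 2 * j"
proof -
  have "(3 * j + 1)^2 - 1 = 3 * (3 * j^2 + 2 * j)"
    by (simp add: power2_eq_square algebra_simps)
  then show ?thesis by (simp add: lower_end_def)
qed

lemma lower_end_two: "lower_end (3 * j + 2) = 3 * j^2 + 4 * j + 1"
proof -
  have "(3 * j + 2)^2 - 1 = 3 * (3 * j^2 + 4 * j + 1)"
    by (simp add: power2_eq_square algebra_simps)
  then show ?thesis by (simp only: lower_end_def) simp
qed

lemma lower_end_next_one:
  "lower_end (next_index (3 * j + 1)) = lower_end (3 * j + 1) + 2 * j + 1"
  unfolding next_index_one lower_end_one lower_end_two by simp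

lemma lower_end_next_two:
  "lower_end (next_index (3 * j + 2)) = lower_end (3 * j + 2) + 4 * j + 4"
  unfolding next_index_two lower_end_one lower_end_two
  by (simp add: power2_eq_square algebra_simps)

lemma lower_end_next_between:
  assumes "k \<in> index_set"
  shows "lower_end k < lower_end (next_index k)" "lower_end (next_index k) < upper_end k"
  using assms
  by (cases rule: index_set_cases;
      simp only: upper_end_def lower_end_next_one lower_end_next_two; simp)+

lemmas block_defs = block_A_def block_B_def block_C_def block_D_def upper_end_def

lemma card_blocks_one:
  "card (block_A (3 * j + 1)) = 2 * j + 2"
  "card (block_B (3 * j + 1)) = 4 * j + 3"
  "card (block_C (3 * j + 1)) = 2 * j + 1"
  "card (block_D (3 * j + 1)) = 4 * j + 4"
  by (simp_all only: block_defs lower_end_next_one card_atLeastAtMost card_atLeastLessThan) simp_all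

lemma card_blocks_two:
  "card (block_A (3 * j + 2)) = 4 * j + 5"
  "card (block_B (3 * j + 2)) = 2 * j + 2"
  "card (block_C (3 * j + 2)) = 4 * j + 4"
  "card (block_D (3 * j + 2)) = 2 * j + 3"
  by (simp_all only: block_defs lower_end_next_two card_atLeastAtMost card_atLeastLessThan) simp_all

lemma coprime_if_twice_is_Suc:
  fixes a b :: nat
  assumes "2 * a = Suc b \<or> b = Suc (2 * a)"
  shows "coprime a b"
proof -
  have "coprime (2 * a) b"
    using assms coprime_Suc_left_nat[of b] coprime_Suc_right_nat[of "2 * a"] by metis
  then show ?thesis by simp
qed

text \<open>
  A common divisor of \<open>a\<close> and \<open>b\<close> divides the difference 2 of \<open>2 * a\<close> and \<open>b\<close>, and as it divides the
  odd number \<open>a\<close> it cannot be 2.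
\<close>
lemma coprime_if_odd_twice_differs_by_two:
  fixes a b :: nat
  assumes "odd a" and "b = 2 * a + 2 \<or> 2 * a = b + 2"
  shows "coprime a b"
proof (rule coprimeI)
  fix d assume d: "d dvd a" "d dvd b"
  then have "d dvd 2 * a" by simp
  then have "d dvd 2"
    using assms(2) d(2) by (metis dvd_add_right_iff)
  moreover have "coprime d 2"
    using assms(1) d(1) by (metis coprime_right_2_iff_odd dvd_trans)
  ultimately show "is_unit d" by (metis coprime_absorb_left)
qed

lemma coprime_blocks:
  assumes "k \<in> index_set"
  shows "coprime (card (block_A k)) (card (block_B k))"
    and "coprime (card (block_C k)) (card (block_D k))"
    and "coprime (card (block_A k)) (card (block_C k))"
    and "coprime (card (block_B k)) (card (block_D k))"
proof -
  have *: "coprime (card (block_A k)) (card (block_B k)) \<and>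
           coprime (card (block_C k)) (card (block_D k)) \<and>
           coprime (card (block_A k)) (card (block_C k)) \<and>
           coprime (card (block_B k)) (card (block_D k))"
    using assms
  proof (cases rule: index_set_cases)
    case (one j)
    have "coprime (2 * j + 2) (4 * j + 3)"
      by (rule coprime_if_twice_is_Suc) simp
    moreover have "coprime (2 * j + 1) (4 * j + 4)"
      by (rule coprime_if_odd_twice_differs_by_two) simp_all
    moreover have "coprime (2 * j + 2) (2 * j + 1)"
      using coprime_Suc_left_nat[of "2 * j + 1"] by simp
    moreover have "coprime (4 * j + 3) (4 * j + 4)"
      using coprime_Suc_right_nat[of "4 * j + 3"] by (simp add: eval_nat_numeral)
    ultimately show ?thesis
      unfolding one card_blocks_one by blast
  next
    case (two j)
    have "coprime (4 * j + 5) (2 * j + 2)"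
      by (subst coprime_commute, rule coprime_if_twice_is_Suc) simp
    moreover have "coprime (4 * j + 4) (2 * j + 3)"
      by (subst coprime_commute, rule coprime_if_odd_twice_differs_by_two) simp_all
    moreover have "coprime (4 * j + 5) (4 * j + 4)"
      using coprime_Suc_left_nat[of "4 * j + 4"] by (simp add: eval_nat_numeral)
    moreover have "coprime (2 * j + 2) (2 * j + 3)"
      using coprime_Suc_right_nat[of "2 * j + 2"] by (simp add: eval_nat_numeral)
    ultimately show ?thesis
      unfolding two card_blocks_two by blast
  qed
  then show "coprime (card (block_A k)) (card (block_B k))"
    and "coprime (card (block_C k)) (card (block_D k))"
    and "coprime (card (block_A k)) (card (block_C k))"
    and "coprime (card (block_B k)) (card (block_D k))"
    by blast+
qed

text \<open>
  The two residue classes of indices cannot collide when one of them yields even values and the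
  other odd values, so injectivity can be checked in each class separately.
\<close>
lemma inj_on_index_set_by_parity:
  fixes f :: "nat \<Rightarrow> nat"
  assumes one: "inj (\<lambda>j. f (3 * j + 1))" and two: "inj (\<lambda>j. f (3 * j + 2))"
    and parity: "\<And>i j. even (f (3 * i + 1)) \<noteq> even (f (3 * j + 2))"
  shows "inj_on f index_set"
proof (rule inj_onI)
  fix k l assume k: "k \<in> index_set" and l: "l \<in> index_set" and eq: "f k = f l"
  show "k = l"
    using k
  proof (cases rule: index_set_cases)
    case k_one: (one i)
    show ?thesis using l
    proof (cases rule: index_set_cases)
      case (one j)
      then show ?thesis using eq k_one injD[OF assms(1), of i j] by simp
    next
      case (two j)
      then show ?thesis using eq k_one parity[of i j] by simp
    qed
  next
    case k_two: (two i)
    show ?thesis using l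
    proof (cases rule: index_set_cases)
      case (one j)
      then show ?thesis using eq k_two parity[of j i] by simp
    next
      case (two j)
      then show ?thesis using eq k_two injD[OF assms(2), of i j] by simp
    qed
  qed
qed

lemma inj_on_card_blocks:
  "inj_on (\<lambda>k. card (block_A k)) index_set"
  "inj_on (\<lambda>k. card (block_B k)) index_set"
  "inj_on (\<lambda>k. card (block_C k)) index_set"
  "inj_on (\<lambda>k. card (block_D k)) index_set"
  by (rule inj_on_index_set_by_parity;
      simp only: card_blocks_one card_blocks_two; simp add: inj_def)+

lemma card_C_Un_card_B_eq_positive:
  "{card (block_C (1 + 3 * j)) |j. j \<ge> 0} \<union> {card (block_B (2 + 3 * j)) |j. j \<ge> 0} = {1..}"
proof -
  have C: "card (block_C (1 + 3 * j)) = 2 * j + 1" for j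
    using card_blocks_one(3)[of j] by (simp only: add.commute)
  have B: "card (block_B (2 + 3 * j)) = 2 * j + 2" for j
    using card_blocks_two(2)[of j] by (simp only: add.commute)
  have "n \<in> {2 * j + 1 |j. j \<ge> 0} \<union> {2 * j + 2 |j. j \<ge> 0} \<longleftrightarrow> n \<in> {1..}" for n :: nat
    unfolding Un_iff mem_Collect_eq atLeast_iff by presburger
  then show ?thesis unfolding C B by (rule set_eqI)
qed

theorem corollary3p3:
  shows "(\<forall>k \<in> index_set.
           {lower_end k .. upper_end k} = block_A k \<union> block_B k \<and> block_A k \<inter> block_B k = {} \<and>
           {lower_end k .. upper_end k} = block_C k \<union> block_D k \<and> block_C k \<inter> block_D k = {} \<and>
           coprime (card (block_A k)) (card (block_B k)) \<and>
           coprime (card (block_C k)) (card (block_D k)) \<and>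
           coprime (card (block_A k)) (card (block_C k)) \<and>
           coprime (card (block_B k)) (card (block_D k))) \<and>
         inj_on (\<lambda>k. card (block_A k)) index_set \<and>
         inj_on (\<lambda>k. card (block_B k)) index_set \<and>
         inj_on (\<lambda>k. card (block_C k)) index_set \<and>
         inj_on (\<lambda>k. card (block_D k)) index_set \<and>
         {card (block_C (1 + 3 * j)) |j. j \<ge> 0} \<union> {card (block_B (2 + 3 * j)) |j. j \<ge> 0} = {1..}"
proof (intro conjI ballI)
  fix k assume k: "k \<in> index_set"
  note between = lower_end_next_between[OF k]
  show "{lower_end k .. upper_end k} = block_A k \<union> block_B k" "block_A k \<inter> block_B k = {}"
    using between by (auto simp: block_A_def block_B_def)
  show "{lower_end k .. upper_end k} = block_C k \<union> block_D k" "block_C k \<inter> block_D k = {}"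
    using between by (auto simp: block_C_def block_D_def)
qed (fact coprime_blocks inj_on_card_blocks card_C_Un_card_B_eq_positive)+

end
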